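(* If $G$ is a bridgeless connected graph of order $n$ with diameter $2$, then $trc(G)\leq n-1$.
   Context: All graphs are finite, simple and undirected. A total-coloring assigns colors to all vertices and edges; a path is total-rainbow if its edges and internal vertices receive pairwise distinct colors; $trc(G)$ is the minimum number of colors in a total-coloring of the connected graph $G$ such that every two distinct vertices are joined by a total-rainbow path. *)

theory Defs
  imports Main
begin

definition simple_graph :: "'a set \<Rightarrow> 'a set set \<Rightarrow> bool" where
  "simple_graph V E \<longleftrightarrow> finite V \<and> (\<forall>e\<in>E. e \<subseteq> V \<and> card e = 2)"

text \<open>A path is represented by the list of its vertices in order.\<close>

fun path_edges :: "'a list \<Rightarrow> 'a set list" where
  "path_edges (u # v # p) = {u, v} # path_edges (v # p)"
| "path_edges _ = []"

definition internal_vertices :: "'a list \<Rightarrow> 'a list" where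
  "internal_vertices p = butlast (tl p)"

definition path_between :: "'a set \<Rightarrow> 'a set set \<Rightarrow> 'a \<Rightarrow> 'a list \<Rightarrow> 'a \<Rightarrow> bool" where
  "path_between V E u p v \<longleftrightarrow>
     p \<noteq> [] \<and> hd p = u \<and> last p = v \<and> distinct p \<and> set p \<subseteq> V \<and> set (path_edges p) \<subseteq> E"

definition graph_connected :: "'a set \<Rightarrow> 'a set set \<Rightarrow> bool" where
  "graph_connected V E \<longleftrightarrow> V \<noteq> {} \<and> (\<forall>u\<in>V. \<forall>v\<in>V. \<exists>p. path_between V E u p v)"

definition graph_components :: "'a set \<Rightarrow> 'a set set \<Rightarrow> 'a set set" where
  "graph_components V E = V // {(u, v). u \<in> V \<and> v \<in> V \<and> (\<exists>p. path_between V E u p v)}"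

definition bridge :: "'a set \<Rightarrow> 'a set set \<Rightarrow> 'a set \<Rightarrow> bool" where
  "bridge V E e \<longleftrightarrow>
     e \<in> E \<and> card (graph_components V (E - {e})) > card (graph_components V E)"

definition bridgeless :: "'a set \<Rightarrow> 'a set set \<Rightarrow> bool" where
  "bridgeless V E \<longleftrightarrow> \<not> (\<exists>e. bridge V E e)"

text \<open>Meaningful only when some path joins the two vertices.\<close>

definition graph_dist :: "'a set \<Rightarrow> 'a set set \<Rightarrow> 'a \<Rightarrow> 'a \<Rightarrow> nat" where
  "graph_dist V E u v =
     (LEAST d. \<exists>p. path_between V E u p v \<and> length (path_edges p) = d)"

text \<open>Meaningful only for finite, nonempty, connected graphs.\<close>

definition graph_diameter :: "'a set \<Rightarrow> 'a set set \<Rightarrow> nat" where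
  "graph_diameter V E = Max {graph_dist V E u v | u v. u \<in> V \<and> v \<in> V}"

text \<open>
  A total-coloring is a function on the disjoint union of vertices (\<open>Inl\<close>) and
  edges (\<open>Inr\<close>), of which only the values on \<open>V <+> E\<close> matter. It need not be proper.
\<close>

definition total_rainbow :: "('a + 'a set \<Rightarrow> nat) \<Rightarrow> 'a list \<Rightarrow> bool" where
  "total_rainbow c p \<longleftrightarrow>
     distinct (map (c \<circ> Inr) (path_edges p) @ map (c \<circ> Inl) (internal_vertices p))"

definition total_rainbow_connecting ::
    "'a set \<Rightarrow> 'a set set \<Rightarrow> ('a + 'a set \<Rightarrow> nat) \<Rightarrow> bool" where
  "total_rainbow_connecting V E c \<longleftrightarrow>
     (\<forall>u\<in>V. \<forall>v\<in>V. u \<noteq> v \<longrightarrow> (\<exists>p. path_between V E u p v \<and> total_rainbow c p))"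

text \<open>
  Meaningful only for finite connected graphs, where an injective coloring shows that
  the minimum is attained.
\<close>

definition trc :: "'a set \<Rightarrow> 'a set set \<Rightarrow> nat" where
  "trc V E =
     (LEAST k. \<exists>c. total_rainbow_connecting V E c \<and> card (c ` (V <+> E)) = k)"

end

theory Submission
  imports Defs "HOL-Number_Theory.Cong"
begin

text \<open>
  Label the vertices with residues modulo \<open>m\<close> so that vertices with equal labels are adjacent.
  Colour each edge with the sum of the labels of its ends, and all vertices with one extra
  colour. The edges of a path \<open>a\<close>, \<open>y\<close>, \<open>b\<close> with \<open>a\<close> and \<open>b\<close> nonadjacent then get different
  colours, so in diameter at most two these \<open>m + 1\<close> colours suffice. Giving the two ends of
  each edge of a matching \<open>M\<close> a common label yields \<open>m = n - |M|\<close>. Finally, a bridgeless connected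
  graph with nonadjacent vertices \<open>u\<close>, \<open>v\<close> has two disjoint edges: if \<open>w\<close> is a neighbour of \<open>v\<close>,
  then \<open>u\<close> has a neighbour other than \<open>w\<close>, as otherwise the edge \<open>uw\<close> would be a bridge.
\<close>

lemma simple_graph_edgeD:
  assumes "simple_graph V E" "{a, b} \<in> E"
  shows "a \<in> V" "b \<in> V" "a \<noteq> b"
  using assms by (auto simp: simple_graph_def)

lemma path_between_singleton: "a \<in> V \<Longrightarrow> path_between V E a [a] a"
  by (simp add: path_between_def)

lemma path_between_edge:
  assumes "simple_graph V E" "{a, b} \<in> E"
  shows "path_between V E a [a, b] b"
  using assms simple_graph_edgeD[OF assms] by (simp add: path_between_def)

lemma path_between_two_edges:
  assumes "simple_graph V E" "{a, y} \<in> E" "{y, b} \<in> E" "a \<noteq> b"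
  shows "path_between V E a [a, y, b] b"
  using assms simple_graph_edgeD[OF assms(1,2)] simple_graph_edgeD[OF assms(1,3)]
  by (simp add: path_between_def)

lemma path_between_first_edge:
  assumes "path_between V E a p b" "a \<noteq> b"
  obtains y where "{a, y} \<in> E"
  using assms by (cases p rule: path_edges.cases) (auto simp: path_between_def)

lemma path_between_length_le_2E:
  assumes "path_between V E a p b" "length (path_edges p) \<le> 2"
  obtains (eq) "a = b" | (edge) "{a, b} \<in> E" | (two_edges) y where "{a, y} \<in> E" "{y, b} \<in> E"
proof (cases p rule: path_edges.cases)
  case (1 a' y q)
  show thesis
  proof (cases q)
    case Nil
    then have "{a, b} \<in> E" using assms 1 by (auto simp: path_between_def)
    then show thesis by (rule edge)
  next
    case (Cons z r)
    then have "r = []" using assms 1 by (cases r) auto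
    then have "{a, y} \<in> E" "{y, b} \<in> E" using assms 1 Cons by (auto simp: path_between_def)
    then show thesis by (rule two_edges)
  qed
qed (use assms eq in \<open>auto simp: path_between_def\<close>)

lemma graph_dist_le_length:
  assumes "path_between V E a p b"
  shows "graph_dist V E a b \<le> length (path_edges p)"
  unfolding graph_dist_def using assms by (blast intro: Least_le)

lemma graph_dist_attained:
  assumes "graph_connected V E" "a \<in> V" "b \<in> V"
  obtains p where "path_between V E a p b" "length (path_edges p) = graph_dist V E a b"
proof -
  have "\<exists>d p. path_between V E a p b \<and> length (path_edges p) = d"
    using assms unfolding graph_connected_def by blast
  then have "\<exists>p. path_between V E a p b \<and> length (path_edges p) = graph_dist V E a b"
    unfolding graph_dist_def by (rule LeastI_ex)
  then show thesis using that by blast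
qed

lemma graph_dist_le_diameter:
  assumes "finite V" "a \<in> V" "b \<in> V"
  shows "graph_dist V E a b \<le> graph_diameter V E"
  unfolding graph_diameter_def using assms by (auto intro!: Max_ge finite_image_set2)

lemma graph_diameter_attained:
  assumes "finite V" "V \<noteq> {}"
  obtains a b where "a \<in> V" "b \<in> V" "graph_dist V E a b = graph_diameter V E"
proof -
  have "graph_diameter V E \<in> {graph_dist V E a b | a b. a \<in> V \<and> b \<in> V}"
    unfolding graph_diameter_def using assms by (intro Max_in finite_image_set2) auto
  then show thesis using that by auto
qed

lemma ex_nonadjacent_if_diameter_ge_2:
  assumes "simple_graph V E" "V \<noteq> {}" "2 \<le> graph_diameter V E"
  obtains u v where "u \<in> V" "v \<in> V" "u \<noteq> v" "{u, v} \<notin> E"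
proof -
  have "finite V" using assms(1) by (simp add: simple_graph_def)
  then obtain u v where uv: "u \<in> V" "v \<in> V" "2 \<le> graph_dist V E u v"
    using graph_diameter_attained assms(2,3) by metis
  have "u \<noteq> v"
    using uv graph_dist_le_length[OF path_between_singleton] by fastforce
  moreover have "{u, v} \<notin> E"
    using uv graph_dist_le_length[OF path_between_edge[OF assms(1)]] by fastforce
  ultimately show thesis using that uv by blast
qed

lemma common_neighbour_if_diameter_le_2:
  assumes "simple_graph V E" "graph_connected V E" "graph_diameter V E \<le> 2"
    and "a \<in> V" "b \<in> V" "a \<noteq> b" "{a, b} \<notin> E"
  obtains y where "{a, y} \<in> E" "{y, b} \<in> E"
proof -
  obtain p where p: "path_between V E a p b" "length (path_edges p) = graph_dist V E a b"
    using graph_dist_attained assms(2,4,5) by metis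
  have "finite V" using assms(1) by (simp add: simple_graph_def)
  then have "length (path_edges p) \<le> 2"
    using p(2) graph_dist_le_diameter[of V a b E] assms(3-5) by linarith
  with p(1) show thesis
    by (cases rule: path_between_length_le_2E) (use assms that in auto)
qed

lemma graph_components_connected:
  assumes "graph_connected V E"
  shows "graph_components V E = {V}"
proof -
  have "{(u, v). u \<in> V \<and> v \<in> V \<and> (\<exists>p. path_between V E u p v)} = V \<times> V" "V \<noteq> {}"
    using assms by (auto simp: graph_connected_def)
  then show ?thesis by (auto simp: graph_components_def quotient_def)
qed

lemma bridge_if_ends_disconnected:
  assumes "simple_graph V E" "graph_connected V E" "{u, w} \<in> E"
    and separated: "\<nexists>p. path_between V (E - {{u, w}}) u p w"
  shows "bridge V E {u, w}"
proof -
  let ?E = "E - {{u, w}}"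
  let ?R = "{(a, b). a \<in> V \<and> b \<in> V \<and> (\<exists>p. path_between V ?E a p b)}"
  have V: "finite V" "u \<in> V" "w \<in> V"
    using assms(1) simple_graph_edgeD[OF assms(1,3)] by (simp_all add: simple_graph_def)
  have "w \<in> ?R `` {w}" "w \<notin> ?R `` {u}"
    using V(3) path_between_singleton[of w V ?E] separated by auto
  then have "?R `` {u} \<noteq> ?R `` {w}" by blast
  then have "2 = card {?R `` {u}, ?R `` {w}}" by simp
  also have "\<dots> \<le> card (graph_components V ?E)"
  proof (rule card_mono)
    show "finite (graph_components V ?E)"
      using V(1) by (auto simp: graph_components_def intro!: finite_quotient)
    show "{?R `` {u}, ?R `` {w}} \<subseteq> graph_components V ?E"
      unfolding graph_components_def using V by (blast intro: quotientI)
  qed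
  finally show ?thesis
    using assms(3) graph_components_connected[OF assms(2)] by (simp add: bridge_def)
qed

lemma connected_neighbour:
  assumes "graph_connected V E" "u \<in> V" "v \<in> V" "u \<noteq> v"
  obtains y where "{u, y} \<in> E"
  using assms path_between_first_edge unfolding graph_connected_def by metis

lemma bridgeless_neighbour_avoiding:
  assumes "simple_graph V E" "graph_connected V E" "bridgeless V E"
    and "u \<in> V" "v \<in> V" "u \<noteq> v"
  obtains x where "{u, x} \<in> E" "x \<noteq> w"
proof (rule ccontr)
  assume "\<not> thesis"
  then have only_w: "\<And>x. {u, x} \<in> E \<Longrightarrow> x = w"
    using that by blast
  then have "{u, w} \<in> E"
    using connected_neighbour[OF assms(2,4-6)] by metis
  then have "u \<noteq> w" by (rule simple_graph_edgeD[OF assms(1)])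
  then have "\<nexists>p. path_between V (E - {{u, w}}) u p w"
    using only_w by (blast elim: path_between_first_edge)
  then have "bridge V E {u, w}"
    using assms(1,2) \<open>{u, w} \<in> E\<close> by (intro bridge_if_ends_disconnected)
  then show False using assms(3) unfolding bridgeless_def by blast
qed

definition matching :: "'a set set \<Rightarrow> 'a set set \<Rightarrow> bool" where
  "matching E M \<longleftrightarrow> M \<subseteq> E \<and> pairwise disjnt M"

lemma bridgeless_matching_card_2:
  assumes G: "simple_graph V E" "graph_connected V E" "bridgeless V E"
    and uv: "u \<in> V" "v \<in> V" "u \<noteq> v" "{u, v} \<notin> E"
  obtains M where "matching E M" "card M = 2"
proof -
  obtain w where w: "{v, w} \<in> E"
    using connected_neighbour[OF G(2) uv(2,1)] uv(3) by metis
  obtain x where x: "{u, x} \<in> E" "x \<noteq> w"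
    using bridgeless_neighbour_avoiding[OF G uv(1-3)] by metis
  have "x \<noteq> v" "w \<noteq> u"
    using uv(4) x(1) w by (auto simp: insert_commute)
  then have "disjnt {u, x} {v, w}" "{u, x} \<noteq> {v, w}"
    using uv(3) x(2) by (auto simp: disjnt_def)
  then have "matching E {{u, x}, {v, w}}" "card {{u, x}, {v, w}} = 2"
    using x(1) w by (auto simp: matching_def pairwise_def disjnt_sym)
  then show thesis by (rule that)
qed

text \<open>Equivalently, a proper vertex colouring of the complement graph.\<close>

definition clique_labelling :: "'a set \<Rightarrow> 'a set set \<Rightarrow> ('a \<Rightarrow> 'b) \<Rightarrow> bool" where
  "clique_labelling V E f \<longleftrightarrow> (\<forall>a\<in>V. \<forall>b\<in>V. f a = f b \<longrightarrow> a \<noteq> b \<longrightarrow> {a, b} \<in> E)"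

lemma clique_labelling_comp:
  assumes "clique_labelling V E f" "inj_on g (f ` V)"
  shows "clique_labelling V E (g \<circ> f)"
  using assms by (auto simp: clique_labelling_def dest: inj_onD)

definition matching_block :: "'a set set \<Rightarrow> 'a \<Rightarrow> 'a set" where
  "matching_block M a = insert a (\<Union>{e \<in> M. a \<in> e})"

lemma matching_block_self: "a \<in> matching_block M a"
  by (simp add: matching_block_def)

lemma matching_block_covered:
  assumes "matching E M" "e \<in> M" "a \<in> e"
  shows "matching_block M a = e"
proof -
  have "{e' \<in> M. a \<in> e'} = {e}"
    using assms by (auto simp: matching_def pairwise_def disjnt_iff)
  then show ?thesis using assms(3) by (auto simp: matching_block_def)
qed

lemma matching_block_uncovered:
  assumes "a \<notin> \<Union>M"
  shows "matching_block M a = {a}"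
  using assms by (auto simp: matching_block_def)

lemma clique_labelling_matching_block:
  assumes "simple_graph V E" "matching E M"
  shows "clique_labelling V E (matching_block M)"
  unfolding clique_labelling_def
proof (intro ballI impI)
  fix a b
  assume same: "matching_block M a = matching_block M b" and "a \<noteq> b"
  have ab: "a \<in> matching_block M a" "b \<in> matching_block M a"
    using matching_block_self[of a M] matching_block_self[of b M] same by simp_all
  then have "a \<in> \<Union>M"
    using \<open>a \<noteq> b\<close> matching_block_uncovered by fastforce
  then obtain e where e: "e \<in> M" "a \<in> e" by blast
  then have "{a, b} \<subseteq> e"
    using ab matching_block_covered[OF assms(2)] by simp
  moreover have "e \<in> E" "card e = 2"
    using assms e(1) by (auto simp: matching_def simple_graph_def)
  ultimately have "{a, b} = e"
    using \<open>a \<noteq> b\<close> by (intro card_subset_eq) (auto intro: card_ge_0_finite)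
  then show "{a, b} \<in> E" using \<open>e \<in> E\<close> by simp
qed

lemma card_Union_matching:
  assumes "simple_graph V E" "matching E M"
  shows "card (\<Union>M) = 2 * card M"
proof -
  have card_edge: "card e = 2" if "e \<in> M" for e
    using assms that by (auto simp: simple_graph_def matching_def)
  have "card (\<Union>M) = sum card M"
    using assms(2) card_edge
    by (intro card_Union_disjoint) (auto simp: matching_def intro: card_ge_0_finite)
  then show ?thesis using card_edge by simp
qed

lemma matching_block_image_Union:
  assumes "matching E M" "{} \<notin> M"
  shows "matching_block M ` \<Union>M = M"
proof -
  have "e \<noteq> {}" if "e \<in> M" for e
    using assms(2) that by blast
  then show ?thesis
    using matching_block_covered[OF assms(1)] by (force simp: image_iff)
qed

lemma card_matching_block_image:
  assumes "simple_graph V E" "matching E M"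
  shows "card (matching_block M ` V) + card M = card V"
proof -
  let ?S = "(\<lambda>a. {a}) ` (V - \<Union>M)"
  have sub: "\<Union>M \<subseteq> V"
    using assms by (auto simp: simple_graph_def matching_def)
  have "{} \<notin> E"
    using assms(1) by (metis card.empty simple_graph_def zero_neq_numeral)
  then have "{} \<notin> M"
    using assms(2) by (auto simp: matching_def)
  have "finite V" using assms(1) by (simp add: simple_graph_def)
  then have "finite (\<Union>M)" using sub by (rule rev_finite_subset)
  then have "finite M" by (rule finite_UnionD)
  have "matching_block M ` V = matching_block M ` \<Union>M \<union> matching_block M ` (V - \<Union>M)"
    using sub by blast
  also have "matching_block M ` \<Union>M = M"
    by (rule matching_block_image_Union[OF assms(2) \<open>{} \<notin> M\<close>])
  also have "matching_block M ` (V - \<Union>M) = ?S"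
    by (intro image_cong) (auto simp: matching_block_uncovered)
  finally have "card (matching_block M ` V) = card (M \<union> ?S)" by simp
  also have "\<dots> = card M + card ?S"
    using \<open>finite V\<close> \<open>finite M\<close> by (intro card_Un_disjoint) auto
  also have "card ?S = card (V - \<Union>M)" by (simp add: card_image)
  also have "\<dots> = card V - 2 * card M"
    using \<open>finite (\<Union>M)\<close> sub card_Union_matching[OF assms] by (simp add: card_Diff_subset)
  finally show ?thesis
    using card_mono[OF \<open>finite V\<close> sub] card_Union_matching[OF assms] by linarith
qed

definition label_sum_coloring :: "nat \<Rightarrow> ('a \<Rightarrow> nat) \<Rightarrow> 'a + 'a set \<Rightarrow> nat" where
  "label_sum_coloring m f = case_sum (\<lambda>_. m) (\<lambda>e. (\<Sum>a\<in>e. f a) mod m)"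

lemma label_sum_coloring_le:
  assumes "0 < m"
  shows "label_sum_coloring m f z \<le> m"
  using assms by (cases z) (auto simp: label_sum_coloring_def intro: less_imp_le)

lemma total_rainbow_edge: "total_rainbow c [a, b]"
  by (simp add: total_rainbow_def internal_vertices_def)

lemma total_rainbow_label_sum_coloring:
  assumes "f a < m" "f b < m" "f a \<noteq> f b" "y \<noteq> a" "y \<noteq> b"
  shows "total_rainbow (label_sum_coloring m f) [a, y, b]"
proof -
  have "(f y + f a) mod m \<noteq> (f y + f b) mod m"
    using assms(1-3) cong_add_lcancel_nat cong_less_modulus_unique_nat
    unfolding cong_def by metis
  moreover have "k mod m \<noteq> m" for k
    using assms(1) mod_less_divisor[of m k] by linarith
  ultimately show ?thesis
    using assms(4,5)
    by (simp add: total_rainbow_def internal_vertices_def label_sum_coloring_def add.commute)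
qed

lemma total_rainbow_connecting_label_sum_coloring:
  assumes G: "simple_graph V E" "graph_connected V E" "graph_diameter V E \<le> 2"
    and "clique_labelling V E f" "f ` V \<subseteq> {..<m}"
  shows "total_rainbow_connecting V E (label_sum_coloring m f)"
  unfolding total_rainbow_connecting_def
proof (intro ballI impI)
  let ?c = "label_sum_coloring m f"
  fix a b assume ab: "a \<in> V" "b \<in> V" "a \<noteq> b"
  show "\<exists>p. path_between V E a p b \<and> total_rainbow ?c p"
  proof (cases "{a, b} \<in> E")
    case True
    then show ?thesis using path_between_edge[OF G(1)] total_rainbow_edge[of _ a b] by metis
  next
    case False
    then obtain y where y: "{a, y} \<in> E" "{y, b} \<in> E"
      using common_neighbour_if_diameter_le_2[OF G ab] by metis
    have "f a \<noteq> f b"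
      using assms(4) ab False by (auto simp: clique_labelling_def)
    then have "total_rainbow ?c [a, y, b]"
      using ab assms(5) y simple_graph_edgeD(3)[OF G(1)]
      by (intro total_rainbow_label_sum_coloring) auto
    then show ?thesis
      using path_between_two_edges[OF G(1) y ab(3)] by blast
  qed
qed

lemma trc_le_card_colors:
  assumes "total_rainbow_connecting V E c"
  shows "trc V E \<le> card (c ` (V <+> E))"
  unfolding trc_def using assms by (blast intro: Least_le)

lemma trc_le_Suc_card_labels:
  assumes "simple_graph V E" "graph_connected V E" "graph_diameter V E \<le> 2"
    and "clique_labelling V E f"
  shows "trc V E \<le> Suc (card (f ` V))"
proof -
  let ?m = "card (f ` V)"
  have V: "finite V" "V \<noteq> {}"
    using assms(1,2) by (auto simp: simple_graph_def graph_connected_def)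
  then obtain g where g: "bij_betw g (f ` V) {..<?m}"
    using ex_bij_betw_finite_nat[of "f ` V"] by (auto simp: atLeast0LessThan)
  let ?c = "label_sum_coloring ?m (g \<circ> f)"
  have "clique_labelling V E (g \<circ> f)" "(g \<circ> f) ` V \<subseteq> {..<?m}"
    using g assms(4) by (auto simp: bij_betw_def intro: clique_labelling_comp)
  then have "trc V E \<le> card (?c ` (V <+> E))"
    using assms(1-3) by (intro trc_le_card_colors total_rainbow_connecting_label_sum_coloring)
  also have "\<dots> \<le> card {..?m}"
    using V by (intro card_mono) (auto simp: card_gt_0_iff intro!: label_sum_coloring_le)
  finally show ?thesis by simp
qed

lemma trc_plus_card_matching_le:
  assumes "simple_graph V E" "graph_connected V E" "graph_diameter V E \<le> 2"
    and "matching E M"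
  shows "trc V E + card M \<le> Suc (card V)"
  using trc_le_Suc_card_labels[OF assms(1-3) clique_labelling_matching_block[OF assms(1,4)]]
    card_matching_block_image[OF assms(1,4)]
  by linarith

theorem theorem4p1:
  fixes V :: "'a set" and E :: "'a set set" and n :: nat
  assumes "simple_graph V E"
    and "graph_connected V E"
    and "bridgeless V E"
    and "card V = n"
    and "graph_diameter V E = 2"
  shows "trc V E \<le> n - 1"
proof -
  have "V \<noteq> {}" using assms(2) by (simp add: graph_connected_def)
  then obtain u v where "u \<in> V" "v \<in> V" "u \<noteq> v" "{u, v} \<notin> E"
    using ex_nonadjacent_if_diameter_ge_2 assms(1,5) by (metis order_refl)
  then obtain M where "matching E M" "card M = 2"
    using bridgeless_matching_card_2 assms(1-3) by metis
  then have "trc V E + 2 \<le> Suc n"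
    using trc_plus_card_matching_le assms by (metis order_refl)
  then show ?thesis by simp
qed

end
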